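(* Let $c\in(0,\frac12)$ be rational, $m=cn$, $t_0=m+1$, and let $H$ be the $n\times n$ independent Poisson matrix associated with the dense Barabási–Albert multigraph (both defined in the context). For $k>t_0$ and $j<k$ set $$p_{kj}:=\frac{d_j(k-1)}{D_{k-1}},\qquad D_{k-1}:=\sum_{v=1}^{k-1}d_v(k-1).$$ Then $$\operatorname{Var}(H_{kj})=\mathbb{E}[p_{kj}],\qquad n\operatorname{Var}(H_{kj})=n\,\mathbb{E}[p_{kj}].$$ Consequently, with $A=[0,c]$, $B=(c,1]$ and $u(t)=(2t-c)^{-1/2}$: if $k\neq j$ are indices (depending on $n$) with $j/n\to x$ and $k/n\to y$, where $(x,y)\in[0,1]^2\setminus(A\times A)$, then $$\sigma^2(x,y):=\lim_{n\to\infty}n\operatorname{Var}(H_{kj})=\frac1cF(x,y),$$ where $F$ is the limiting mean kernel $$F(x,y)=\begin{cases}\sqrt{c}\,u(y),&x\in A,\ y\in B,\\ \sqrt c\,u(x),&x\in B,\ y\in A,\\ c\,u(x)u(y),&x,y\in B,\end{cases}$$ while $\operatorname{Var}(H_{kj})=0$ whenever $k,j\le t_0$, and one sets $\sigma^2=0$ on $A\times A$. Equivalently, $$\sigma^2(x,y)=\begin{cases}0,&x,y\in A,\\ \frac{1}{\sqrt c}u(y),&x\in A,\ y\in B,\\ \frac1{\sqrt c}u(x),&x\in B,\ y\in A,\\ u(x)u(y),&x,y\in B.\end{cases}$$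
   Context: Model. Fix rational $c\in(0,\frac12)$ and consider only integers $n$ such that $m:=cn$ is an integer; limits are along this sequence. Let $t_0:=m+1$. At time $t_0$ the graph is the simple complete graph on vertices $1,\dots,m+1$. For each $t=t_0+1,\dots,n$ a new vertex $t$ is added together with $m$ edges; conditionally on the graph at time $t-1$, the $m$ edges are placed independently, each joining $t$ to vertex $j<t$ with probability $d_j(t-1)/D_{t-1}$, where $d_j(s)$ is the degree of $j$ at time $s$ (counted with edge multiplicity) and $D_s=\sum_{v\le s}d_v(s)=2ms-m(m+1)$ for $s\ge t_0$. Multiple edges are allowed. $M$ is the symmetric $n\times n$ matrix whose $(k,j)$ entry is the number of edges between $k$ and $j$ in the final graph (with $M_{kk}=0$). Independent Poisson matrix. For $k>t_0$, $j<k$ put $\bar\lambda_{kj}:=\mathbb{E}[M_{kj}]$ and let $P_{kj}\sim\mathrm{Poisson}(\bar\lambda_{kj})$ be independent. $H$ is the symmetric matrix with $H_{kj}=H_{jk}=(P_{kj}-\bar\lambda_{kj})/\sqrt m$ for $k>t_0$, $j<k$, and all other entries (diagonal entries and entries with $k,j\le t_0$) equal to $0$. *)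

theory Defs
  imports "HOL-Probability.Probability"
begin

section \<open>The dense Barabasi--Albert multigraph\<close>

text \<open>
  A multigraph on vertices \<open>1, 2, \<dots>\<close> is given by its edge multiplicities; only finitely many of
  them are nonzero in the process below.
\<close>

type_synonym multigraph = "nat \<Rightarrow> nat \<Rightarrow> nat"

definition complete_graph :: "nat \<Rightarrow> multigraph" where
  "complete_graph s = (\<lambda>k j. if k \<in> {1..s} \<and> j \<in> {1..s} \<and> k \<noteq> j then 1 else 0)"

text \<open>Degree of \<open>j\<close>, and sum of all degrees, in a multigraph on the vertices \<open>1..s\<close>.\<close>

definition deg :: "multigraph \<Rightarrow> nat \<Rightarrow> nat \<Rightarrow> nat" where
  "deg G s j = (\<Sum>v\<in>{1..s}. G j v)"

definition total_deg :: "multigraph \<Rightarrow> nat \<Rightarrow> nat" where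
  "total_deg G s = (\<Sum>v\<in>{1..s}. deg G s v)"

text \<open>
  \<open>embed_pmf\<close> is only meaningful if the weights sum to 1, i.e. if the total degree is nonzero. This
  is the case for every graph reached by the process when \<open>m \<ge> 1\<close>, see \<open>total_deg_ba_path\<close>.
\<close>

definition attach_pmf :: "multigraph \<Rightarrow> nat \<Rightarrow> nat pmf" where
  "attach_pmf G s =
     embed_pmf (\<lambda>j. if j \<in> {1..s} then real (deg G s j) / real (total_deg G s) else 0)"

text \<open>Add vertex \<open>t\<close> with \<open>m\<close> edges, the \<open>i\<close>-th of which goes to \<open>e i\<close>.\<close>

definition add_vertex :: "nat \<Rightarrow> nat \<Rightarrow> (nat \<Rightarrow> nat) \<Rightarrow> multigraph \<Rightarrow> multigraph" where
  "add_vertex m t e G = (\<lambda>k j. G k j + card {i \<in> {1..m}. {k, j} = {t, e i}})"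

text \<open>
  \<open>ba_path m n\<close> is the law of the whole trajectory \<open>\<omega>\<close> up to time \<open>n\<close>, where \<open>\<omega> s\<close> is the graph at
  time \<open>s\<close>. The process starts at \<open>t\<^sub>0 = m + 1\<close>; the values \<open>\<omega> s\<close> with \<open>s < t\<^sub>0\<close> or \<open>s > n\<close> are
  irrelevant and are set to the initial graph.
\<close>

primrec ba_path :: "nat \<Rightarrow> nat \<Rightarrow> (nat \<Rightarrow> multigraph) pmf" where
  "ba_path m 0 = return_pmf (\<lambda>_. complete_graph (m + 1))"
| "ba_path m (Suc s) =
     (if Suc s \<le> m + 1 then return_pmf (\<lambda>_. complete_graph (m + 1))
      else bind_pmf (ba_path m s) (\<lambda>\<omega>.
             map_pmf (\<lambda>e. fun_upd \<omega> (Suc s) (add_vertex m (Suc s) e (\<omega> s)))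
               (Pi_pmf {1..m} 0 (\<lambda>_. attach_pmf (\<omega> s) s))))"

definition attach_prob :: "nat \<Rightarrow> nat \<Rightarrow> (nat \<Rightarrow> multigraph) \<Rightarrow> real" where
  "attach_prob k j \<omega> =
     real (deg (\<omega> (k - 1)) (k - 1) j) / real (total_deg (\<omega> (k - 1)) (k - 1))"

definition mean_attach_prob :: "nat \<Rightarrow> nat \<Rightarrow> nat \<Rightarrow> nat \<Rightarrow> real" where
  "mean_attach_prob m n k j = measure_pmf.expectation (ba_path m n) (attach_prob k j)"

definition mean_mult :: "nat \<Rightarrow> nat \<Rightarrow> nat \<Rightarrow> nat \<Rightarrow> real" where
  "mean_mult m n k j = measure_pmf.expectation (ba_path m n) (\<lambda>\<omega>. real (\<omega> n k j))"


section \<open>The independent Poisson matrix\<close>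

definition poisson_index :: "nat \<Rightarrow> nat \<Rightarrow> (nat \<times> nat) set" where
  "poisson_index m n = {(k, j). m + 1 < k \<and> k \<le> n \<and> 1 \<le> j \<and> j < k}"

definition independent_poisson ::
    "nat \<Rightarrow> nat \<Rightarrow> 'a measure \<Rightarrow> (nat \<Rightarrow> nat \<Rightarrow> 'a \<Rightarrow> nat) \<Rightarrow> bool" where
  "independent_poisson m n \<Omega> P \<longleftrightarrow>
     prob_space \<Omega> \<and>
     prob_space.indep_vars \<Omega> (\<lambda>_. count_space UNIV) (\<lambda>(k, j). P k j) (poisson_index m n) \<and>
     (\<forall>(k, j) \<in> poisson_index m n.
        distr \<Omega> (count_space UNIV) (P k j) = measure_pmf (poisson_pmf (mean_mult m n k j)))"

definition poisson_H ::
    "nat \<Rightarrow> nat \<Rightarrow> (nat \<Rightarrow> nat \<Rightarrow> 'a \<Rightarrow> nat) \<Rightarrow> nat \<Rightarrow> nat \<Rightarrow> 'a \<Rightarrow> real" where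
  "poisson_H m n P k j x =
     (if (k, j) \<in> poisson_index m n then (real (P k j x) - mean_mult m n k j) / sqrt (real m)
      else if (j, k) \<in> poisson_index m n then (real (P j k x) - mean_mult m n j k) / sqrt (real m)
      else 0)"


section \<open>The dense limit\<close>

text \<open>The sizes \<open>n\<close> for which \<open>m = c n\<close> is an integer; all limits are taken along these.\<close>

definition admissible :: "real \<Rightarrow> nat set" where
  "admissible c = {n. 0 < n \<and> c * real n \<in> \<int>}"

definition edges_per_vertex :: "real \<Rightarrow> nat \<Rightarrow> nat" where
  "edges_per_vertex c n = nat \<lfloor>c * real n\<rfloor>"

text \<open>\<open>\<Omega> n\<close> and \<open>P n\<close> are the probability space and the Poisson variables used for size \<open>n\<close>.\<close>

definition variance_H ::
    "real \<Rightarrow> (nat \<Rightarrow> 'a measure) \<Rightarrow> (nat \<Rightarrow> nat \<Rightarrow> nat \<Rightarrow> 'a \<Rightarrow> nat) \<Rightarrow> nat \<Rightarrow> nat \<Rightarrow> nat \<Rightarrow> real" where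
  "variance_H c \<Omega> P n k j =
     prob_space.variance (\<Omega> n) (poisson_H (edges_per_vertex c n) n (P n) k j)"

definition along :: "real \<Rightarrow> nat filter" where
  "along c = inf sequentially (principal (admissible c))"

definition index_sequences ::
    "real \<Rightarrow> real \<Rightarrow> real \<Rightarrow> (nat \<Rightarrow> nat) \<Rightarrow> (nat \<Rightarrow> nat) \<Rightarrow> bool" where
  "index_sequences c x y j k \<longleftrightarrow>
     (\<forall>n \<in> admissible c. j n \<in> {1..n} \<and> k n \<in> {1..n} \<and> k n \<noteq> j n) \<and>
     ((\<lambda>n. real (j n) / real n) \<longlongrightarrow> x) (along c) \<and>
     ((\<lambda>n. real (k n) / real n) \<longlongrightarrow> y) (along c)"

definition set_A :: "real \<Rightarrow> real set" where "set_A c = {0..c}"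

definition set_B :: "real \<Rightarrow> real set" where "set_B c = {c<..1}"

definition kernel_u :: "real \<Rightarrow> real \<Rightarrow> real" where
  "kernel_u c t = (2 * t - c) powr (- 1 / 2)"

text \<open>The limiting mean kernel; it is only used off \<open>A \<times> A\<close>.\<close>

definition mean_kernel :: "real \<Rightarrow> real \<Rightarrow> real \<Rightarrow> real" where
  "mean_kernel c x y =
     (if x \<in> set_A c \<and> y \<in> set_B c then sqrt c * kernel_u c y
      else if x \<in> set_B c \<and> y \<in> set_A c then sqrt c * kernel_u c x
      else if x \<in> set_B c \<and> y \<in> set_B c then c * kernel_u c x * kernel_u c y
      else undefined)"

text \<open>
  The limit of \<open>n Var H(k\<^sub>n, j\<^sub>n)\<close> common to all index sequences with \<open>j\<^sub>n/n \<rightarrow> x\<close> and \<open>k\<^sub>n/n \<rightarrow> y\<close>,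
  and 0 by convention on \<open>A \<times> A\<close>. That the limit exists has to be asserted separately.
\<close>

definition variance_profile ::
    "real \<Rightarrow> (nat \<Rightarrow> 'a measure) \<Rightarrow> (nat \<Rightarrow> nat \<Rightarrow> nat \<Rightarrow> 'a \<Rightarrow> nat) \<Rightarrow>
       real \<Rightarrow> real \<Rightarrow> real" where
  "variance_profile c \<Omega> P x y =
     (if x \<in> set_A c \<and> y \<in> set_A c then 0
      else THE l. \<forall>j k. index_sequences c x y j k \<longrightarrow>
             ((\<lambda>n. real n * variance_H c \<Omega> P n (k n) (j n)) \<longlongrightarrow> l) (along c))"


section \<open>Well-definedness\<close>

lemma along_nontrivial:
  assumes "c \<in> \<rat>"
  shows "along c \<noteq> bot"
proof
  assume bot: "along c = bot"
  obtain a b :: int where ab: "b > 0" "c = of_int a / of_int b"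
    using assms by (metis Rats_cases')
  have "eventually (\<lambda>n. n \<notin> admissible c) sequentially"
    using bot unfolding along_def trivial_limit_def eventually_inf_principal by simp
  then obtain N where N: "\<And>n. n \<ge> N \<Longrightarrow> n \<notin> admissible c"
    by (auto simp: eventually_sequentially)
  let ?n = "nat b * Suc N"
  have "c * real ?n = of_int (a * int (Suc N))"
    using ab by (simp add: field_simps)
  hence "?n \<in> admissible c"
    unfolding admissible_def using ab(1)
    by (metis (mono_tags) Ints_of_int mem_Collect_eq mult_pos_pos
        nat_0_less_mult_iff zero_less_Suc zero_less_nat_eq)
  moreover have "1 * Suc N \<le> ?n" using ab(1) by (intro mult_right_mono) auto
  hence "?n \<ge> N" by (metis Suc_leD mult_1)
  ultimately show False using N by blast
qed

lemma pmf_attach_pmf: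
  assumes "total_deg G s > 0"
  shows "pmf (attach_pmf G s) j =
           (if j \<in> {1..s} then real (deg G s j) / real (total_deg G s) else 0)"
  unfolding attach_pmf_def
proof (rule pmf_embed_pmf)
  let ?f = "\<lambda>j. if j \<in> {1..s} then real (deg G s j) / real (total_deg G s) else 0"
  show "0 \<le> ?f x" for x by simp
  have "(\<integral>\<^sup>+x. ennreal (?f x) \<partial>count_space UNIV) = (\<Sum>x\<in>{1..s}. ennreal (?f x))"
    by (rule nn_integral_count_space') auto
  also have "\<dots> = ennreal (\<Sum>x\<in>{1..s}. ?f x)" by (rule sum_ennreal) simp
  also have "(\<Sum>x\<in>{1..s}. ?f x) = 1"
  proof -
    have "(\<Sum>x\<in>{1..s}. ?f x) = (\<Sum>x\<in>{1..s}. real (deg G s x)) / real (total_deg G s)"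
      by (simp add: sum_divide_distrib)
    also have "\<dots> = real (total_deg G s) / real (total_deg G s)"
      by (simp add: total_deg_def)
    finally show ?thesis using assms by simp
  qed
  finally show "(\<integral>\<^sup>+x. ennreal (?f x) \<partial>count_space UNIV) = 1" by simp
qed

lemma total_deg_add_vertex:
  assumes "\<And>k j. k > s \<or> j > s \<Longrightarrow> G k j = 0" "\<And>i. i \<in> {1..m} \<Longrightarrow> e i \<in> {1..s}"
  shows "total_deg (add_vertex m (Suc s) e G) (Suc s) = total_deg G s + 2 * m"
proof -
  let ?G = "add_vertex m (Suc s) e G"
  have fib: "(\<Sum>v\<in>{1..s}. card {i \<in> {1..m}. e i = v}) = m"
  proof -
    have "(\<Sum>v\<in>{1..s}. card {i \<in> {1..m}. e i = v}) = (\<Sum>i\<in>{1..m}. card {v \<in> {1..s}. e i = v})"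
      by (rule sum_multicount_gen) auto
    also have "\<dots> = (\<Sum>i\<in>{1..m}. 1)"
    proof (rule sum.cong)
      fix i assume "i \<in> {1..m}"
      hence "{v \<in> {1..s}. e i = v} = {e i}" using assms(2)[of i] by blast
      thus "card {v \<in> {1..s}. e i = v} = 1" by simp
    qed simp
    finally show ?thesis by simp
  qed
  have 1: "?G v w = G v w" if "v \<in> {1..s}" "w \<in> {1..s}" for v w
    using that unfolding add_vertex_def by (auto simp: doubleton_eq_iff)
  have 2: "?G (Suc s) v = card {i \<in> {1..m}. e i = v}" "?G v (Suc s) = card {i \<in> {1..m}. e i = v}"
    if "v \<in> {1..s}" for v
    using that assms(1) unfolding add_vertex_def
    by (auto simp: doubleton_eq_iff intro!: arg_cong[where f = card])
  have 3: "?G (Suc s) (Suc s) = 0"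
    using assms unfolding add_vertex_def by (fastforce simp: doubleton_eq_iff)
  have "total_deg ?G (Suc s)
          = (\<Sum>v\<in>{1..s}. (\<Sum>w\<in>{1..s}. ?G v w) + ?G v (Suc s)) + (\<Sum>w\<in>{1..s}. ?G (Suc s) w)"
    using 3 by (simp add: total_deg_def deg_def)
  also have "\<dots> = (\<Sum>v\<in>{1..s}. (\<Sum>w\<in>{1..s}. G v w)) + m + m"
    using 1 2 fib by (simp add: sum.distrib)
  finally show ?thesis by (simp add: total_deg_def deg_def)
qed

lemma total_deg_ba_path:
  assumes "m \<ge> 1" "s \<ge> m + 1" "\<omega> \<in> set_pmf (ba_path m s)"
  shows "(\<forall>k j. k > s \<or> j > s \<longrightarrow> \<omega> s k j = 0) \<and>
         int (total_deg (\<omega> s) s) = 2 * int m * int s - int m * (int m + 1) \<and>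
         total_deg (\<omega> s) s > 0"
  using assms(2,3)
proof (induction s arbitrary: \<omega> rule: dec_induct)
  case base
  have w: "\<omega> (m + 1) = complete_graph (m + 1)" using base by simp
  have "deg (complete_graph (m + 1)) (m + 1) v = m" if "v \<in> {1..m+1}" for v
  proof -
    have "deg (complete_graph (m + 1)) (m + 1) v = (\<Sum>w\<in>{1..m+1} - {v}. 1)"
      unfolding deg_def complete_graph_def using that
      by (intro sum.mono_neutral_cong_right) auto
    thus ?thesis using that by simp
  qed
  hence "total_deg (complete_graph (m + 1)) (m + 1) = (m + 1) * m"
    by (simp add: total_deg_def del: sum.cl_ivl_Suc)
  thus ?case using w assms(1) by (simp add: complete_graph_def algebra_simps)
next
  case (step s)
  obtain \<omega>' e where w: "\<omega>' \<in> set_pmf (ba_path m s)"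
    "e \<in> set_pmf (Pi_pmf {1..m} 0 (\<lambda>_. attach_pmf (\<omega>' s) s))"
    "\<omega> (Suc s) = add_vertex m (Suc s) e (\<omega>' s)"
    using step by (auto simp: set_map_pmf)
  note IH = step.IH[OF w(1)]
  have e: "e i \<in> {1..s}" if "i \<in> {1..m}" for i
  proof -
    have "e i \<in> set_pmf (attach_pmf (\<omega>' s) s)"
      using w(2) that by (auto simp: set_Pi_pmf PiE_dflt_def)
    thus ?thesis using IH by (auto simp: set_pmf_iff pmf_attach_pmf split: if_splits)
  qed
  have "total_deg (\<omega> (Suc s)) (Suc s) = total_deg (\<omega>' s) s + 2 * m"
    unfolding w(3) using IH e by (intro total_deg_add_vertex) auto
  moreover have "\<omega> (Suc s) k j = 0" if "k > Suc s \<or> j > Suc s" for k j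
    unfolding w(3) add_vertex_def using that IH e by (fastforce simp: doubleton_eq_iff)
  ultimately show ?case using IH by (auto simp: algebra_simps)
qed

lemma independent_poisson_exists:
  "\<exists>(\<Omega> :: (nat \<times> nat \<Rightarrow> nat) measure) P. independent_poisson m n \<Omega> P"
proof -
  let ?I = "poisson_index m n"
  let ?p = "\<lambda>(k, j). poisson_pmf (mean_mult m n k j)"
  let ?\<Omega> = "measure_pmf (Pi_pmf ?I 0 ?p)"
  have fin: "finite ?I"
    by (rule finite_subset[of _ "{..n} \<times> {..n}"]) (auto simp: poisson_index_def)
  have "(\<lambda>(k, j). \<lambda>f. f (k, j)) = (\<lambda>x (f :: nat \<times> nat \<Rightarrow> nat). f x)" by auto
  moreover have "distr ?\<Omega> (count_space UNIV) (\<lambda>f. f (k, j))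
                   = measure_pmf (poisson_pmf (mean_mult m n k j))" if "(k, j) \<in> ?I" for k j
    using Pi_pmf_component[OF fin, of "(k, j)" 0 ?p] that
    by (metis case_prod_conv map_pmf_rep_eq)
  ultimately have "independent_poisson m n ?\<Omega> (\<lambda>k j f. f (k, j))"
    unfolding independent_poisson_def
    using indep_vars_Pi_pmf[OF fin, of 0 ?p] measure_pmf.prob_space_axioms by auto
  thus ?thesis by blast
qed

end

theory Submission
  imports Defs
begin

text \<open>
  The variance of a Poisson variable is its mean, and each of the \<open>m\<close> edges of vertex \<open>k\<close> hits \<open>j\<close>
  with conditional probability \<open>p\<^sub>k\<^sub>j\<close> given the past, so that \<open>\<bar>\<lambda>\<^sub>k\<^sub>j = m E p\<^sub>k\<^sub>j\<close> and
  \<open>Var H\<^sub>k\<^sub>j = \<bar>\<lambda>\<^sub>k\<^sub>j / m = E p\<^sub>k\<^sub>j\<close>: this is \<open>mean_mult_eq_mean_attach_prob\<close> together with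
  \<open>variance_H_eq_mean_attach_prob\<close>.

  What remains is the size of \<open>E p\<^sub>k\<^sub>j\<close>. The total degree \<open>D\<^sub>s = m (2 s - m - 1)\<close> is deterministic,
  so the mean degree of a fixed vertex obeys a linear recursion: it is multiplied by
  \<open>1 + m / D\<^sub>s = 1 + 1 / (2 s - m - 1)\<close> in step \<open>s\<close>. It starts from the value \<open>m\<close>, both for the
  initial vertices (at time \<open>m + 1\<close>) and for a later vertex \<open>j\<close> (at time \<open>j\<close>). With
  \<open>a\<^sub>s = 2 s - m - 1\<close> and \<open>i = max j (m + 1)\<close> this gives
  \<open>E p\<^sub>k\<^sub>j = (\<Prod>i \<le> r < k - 1. 1 + 1 / a\<^sub>r) / a\<^sub>k\<^sub>-\<^sub>1\<close>.

  As \<open>a\<^sub>r\<close> grows by 2 in each step, the square of the product lies between two telescoping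
  products, namely \<open>a\<^sub>k\<^sub>-\<^sub>1 / a\<^sub>i\<close> and \<open>(a\<^sub>k\<^sub>-\<^sub>1 - 1) / (a\<^sub>i - 1)\<close> (lemma \<open>growth_factor_bounds\<close>).
  Both are asymptotic to \<open>(2 y - c) / (2 max(x, c) - c)\<close> when \<open>j < k\<close>, \<open>j/n \<rightarrow> x\<close> and \<open>k/n \<rightarrow> y > c\<close>. Hence
  \<open>n E p\<^sub>k\<^sub>j \<rightarrow> u(max(x, c)) u(y)\<close>.

  The three cases of the profile are one formula: since \<open>H\<close> is symmetric, the smaller
  and the larger of the two indices take the roles of \<open>j\<close> and \<open>k\<close>, and the limit is
  \<open>u(max(min(x, y), c)) u(max(x, y))\<close>, where \<open>u(c) = 1 / \<surd>c\<close>. Working with \<open>min\<close> and \<open>max\<close> also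
  covers \<open>x = y\<close>, where the order of \<open>j\<close> and \<open>k\<close> may change with \<open>n\<close>.
\<close>

section \<open>The variance of the Poisson distribution\<close>

lemma has_bochner_integral_measure_pmf_nat:
  fixes p :: "nat pmf" and f :: "nat \<Rightarrow> real"
  assumes "\<And>k. f k \<ge> 0" "(\<lambda>k. pmf p k * f k) sums s"
  shows "has_bochner_integral (measure_pmf p) f s"
proof -
  have int: "integrable (count_space UNIV) (\<lambda>k. pmf p k * f k)"
    using assms by (simp add: integrable_count_space_nat_iff abs_mult sums_iff)
  have "integrable (measure_pmf p) f"
    unfolding measure_pmf_eq_density using int by (subst integrable_density) auto
  moreover have "integral\<^sup>L (measure_pmf p) f = s"
    unfolding measure_pmf_eq_density
    using int assms(2) by (subst integral_density) (auto simp: integral_count_space_nat sums_iff)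
  ultimately show ?thesis by (simp add: has_bochner_integral_iff)
qed

text \<open>
  Both series reduce to the exponential series after the index shift
  \<open>(k + 1) r\<^sup>k\<^sup>+\<^sup>1 / (k + 1)! = r (r\<^sup>k / k!)\<close>.
\<close>

lemma poisson_moments:
  fixes r :: real
  assumes "r > 0"
  shows "has_bochner_integral (measure_pmf (poisson_pmf r)) (\<lambda>k. real k) r"
    and "has_bochner_integral (measure_pmf (poisson_pmf r)) (\<lambda>k. (real k)\<^sup>2) (r\<^sup>2 + r)"
proof -
  have E: "(\<lambda>k. r ^ k / fact k * exp (- r)) sums 1"
    using sums_mult2[OF exp_converges[of r], of "exp (- r)"] by (simp add: exp_minus field_simps)
  have shift: "r ^ Suc k / fact (Suc k) * exp (- r) * real (Suc k) = r * (r ^ k / fact k * exp (- r))" for k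
    by (simp add: field_simps del: of_nat_Suc)
  have "(\<lambda>k. r ^ Suc k / fact (Suc k) * exp (- r) * real (Suc k)) sums r"
    using sums_mult[OF E, of r] unfolding shift by simp
  hence mean: "(\<lambda>k. r ^ k / fact k * exp (- r) * real k) sums r"
    by (subst (asm) sums_Suc_iff) simp
  thus "has_bochner_integral (measure_pmf (poisson_pmf r)) (\<lambda>k. real k) r"
    by (intro has_bochner_integral_measure_pmf_nat) (simp_all add: assms)
  have "(\<lambda>k. r ^ Suc k / fact (Suc k) * exp (- r) * (real (Suc k))\<^sup>2) sums (r * (r + 1))"
  proof -
    have "r ^ Suc k / fact (Suc k) * exp (- r) * (real (Suc k))\<^sup>2
            = r * (r ^ k / fact k * exp (- r) * real k + r ^ k / fact k * exp (- r))" for k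
      unfolding power2_eq_square mult.assoc[symmetric] shift by (simp add: field_simps)
    thus ?thesis using sums_mult[OF sums_add[OF mean E], of r] by simp
  qed
  hence "(\<lambda>k. r ^ k / fact k * exp (- r) * (real k)\<^sup>2) sums (r * (r + 1))"
    by (subst (asm) sums_Suc_iff) simp
  thus "has_bochner_integral (measure_pmf (poisson_pmf r)) (\<lambda>k. (real k)\<^sup>2) (r\<^sup>2 + r)"
    by (intro has_bochner_integral_measure_pmf_nat)
       (simp_all add: assms power2_eq_square algebra_simps)
qed

lemma (in prob_space) poisson_variance:
  assumes [measurable]: "X \<in> M \<rightarrow>\<^sub>M count_space UNIV"
    and X: "distr M (count_space UNIV) X = measure_pmf (poisson_pmf r)" and "r > 0"
  shows "variance (\<lambda>x. (real (X x) - a) / b) = r / b\<^sup>2"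
proof -
  have transfer: "has_bochner_integral M (\<lambda>x. f (X x)) s"
    if "has_bochner_integral (measure_pmf (poisson_pmf r)) f s" for f :: "nat \<Rightarrow> real" and s
  proof -
    have "has_bochner_integral (distr M (count_space UNIV) X) f s" using that X by simp
    thus ?thesis by (simp add: has_bochner_integral_iff integrable_distr_eq integral_distr)
  qed
  have 1: "has_bochner_integral M (\<lambda>x. real (X x)) r"
    using poisson_moments(1)[OF assms(3)] by (rule transfer)
  have 2: "has_bochner_integral M (\<lambda>x. (real (X x))\<^sup>2) (r\<^sup>2 + r)"
    using poisson_moments(2)[OF assms(3)] by (rule transfer)
  have mean: "expectation (\<lambda>x. (real (X x) - a) / b) = (r - a) / b"
    using 1 by (simp add: has_bochner_integral_iff prob_space)
  have "((real (X x) - a) / b - (r - a) / b)\<^sup>2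
          = ((real (X x))\<^sup>2 - 2 * r * real (X x) + r\<^sup>2) / b\<^sup>2" for x
    by (simp add: power2_eq_square algebra_simps flip: diff_divide_distrib)
  thus ?thesis
    using 1 2 unfolding mean
    by (simp add: has_bochner_integral_iff prob_space power2_eq_square)
qed

section \<open>The trajectory of the multigraph process\<close>

text \<open>
  Later steps only update later coordinates of the trajectory, so expectations of functions of the
  graph at time \<open>s\<close> may be computed in the process stopped at time \<open>s\<close>.
\<close>

lemma ba_path_marginal:
  assumes "s \<le> n" "m + 1 \<le> s"
  shows "map_pmf (\<lambda>\<omega>. \<omega> s) (ba_path m n) = map_pmf (\<lambda>\<omega>. \<omega> s) (ba_path m s)"
  using assms(1)
proof (induction n rule: dec_induct)
  case (step n)
  have "map_pmf (\<lambda>\<omega>. \<omega> s) (ba_path m (Suc n)) = map_pmf (\<lambda>\<omega>. \<omega> s) (ba_path m n)"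
    using step(1) assms(2) by (simp add: map_bind_pmf pmf.map_comp o_def bind_return_pmf')
      (simp add: map_pmf_def)
  thus ?case using step.IH by simp
qed simp

lemma set_Pi_pmf_attach:
  fixes m :: nat
  assumes "total_deg G s > 0" "e \<in> set_pmf (Pi_pmf {1..m} 0 (\<lambda>_. attach_pmf G s))" "i \<in> {1..m}"
  shows "e i \<in> {1..s}"
proof -
  have "e i \<in> set_pmf (attach_pmf G s)"
    using assms(2,3) by (auto simp: set_Pi_pmf PiE_dflt_def)
  thus ?thesis using assms(1) by (auto simp: set_pmf_iff pmf_attach_pmf split: if_splits)
qed

lemma finite_set_Pi_pmf_attach:
  fixes m :: nat
  assumes "total_deg G s > 0"
  shows "finite (set_pmf (Pi_pmf {1..m} 0 (\<lambda>_. attach_pmf G s)))"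
proof (rule finite_subset)
  show "set_pmf (Pi_pmf {1..m} 0 (\<lambda>_. attach_pmf G s)) \<subseteq> PiE_dflt {1..m} 0 (\<lambda>_. {1..s})"
    using set_Pi_pmf_attach[OF assms] by (auto simp: PiE_dflt_def set_Pi_pmf)
qed (intro finite_PiE_dflt; simp)

text \<open>
  Finiteness of the support makes every function of the trajectory integrable and turns the
  conditioning on the past into a finite sum.
\<close>

lemma finite_set_ba_path:
  assumes "m \<ge> 1"
  shows "finite (set_pmf (ba_path m s))"
proof (induction s)
  case (Suc s)
  have "finite (set_pmf (Pi_pmf {1..m} 0 (\<lambda>_. attach_pmf (\<omega> s) s)))"
    if "m + 1 \<le> s" "\<omega> \<in> set_pmf (ba_path m s)" for \<omega>
    using total_deg_ba_path[OF assms that] finite_set_Pi_pmf_attach by blast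
  thus ?case using Suc.IH by (auto simp: set_map_pmf)
qed simp

lemma integrable_ba_path:
  fixes f :: "_ \<Rightarrow> real"
  shows "m \<ge> 1 \<Longrightarrow> integrable (measure_pmf (ba_path m s)) f"
  by (intro integrable_measure_pmf_finite finite_set_ba_path)

lemma expectation_number_of_hits:
  fixes p :: "'b pmf"
  assumes "finite A"
  shows "measure_pmf.expectation (Pi_pmf A dflt (\<lambda>_. p)) (\<lambda>e. real (card {i \<in> A. e i = j}))
           = card A * pmf p j"
proof -
  let ?P = "Pi_pmf A dflt (\<lambda>_. p)"
  have "real (card {i \<in> A. e i = j}) = (\<Sum>i\<in>A. indicator {j} (e i))" for e
    using assms by (simp add: indicator_def sum.If_cases Int_def conj_commute)
  moreover have "measure_pmf.expectation ?P (\<lambda>e. indicator {j} (e i) :: real) = pmf p j"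
    if "i \<in> A" for i
  proof -
    have "measure_pmf.expectation ?P (\<lambda>e. indicator {j} (e i) :: real)
            = measure_pmf.expectation (map_pmf (\<lambda>e. e i) ?P) (indicator {j})"
      by (simp only: integral_map_pmf)
    also have "map_pmf (\<lambda>e. e i) ?P = p"
      using that assms by (simp add: Pi_pmf_component)
    also have "measure_pmf.expectation p (indicator {j}) = pmf p j"
      by (simp add: pmf.rep_eq)
    finally show ?thesis .
  qed
  moreover have "integrable (measure_pmf ?P) (\<lambda>e. indicator {j} (e i) :: real)" for i
    by (intro measure_pmf.integrable_const_bound[of _ 1]) (auto simp: indicator_def)
  ultimately show ?thesis by (simp add: Bochner_Integration.integral_sum)
qed

lemma ba_path_step:
  assumes "m \<ge> 1" "s \<ge> m + 1" "\<omega> \<in> set_pmf (ba_path m (Suc s))" "j \<in> {1..s}"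
  shows "deg (\<omega> (Suc s)) (Suc s) j = deg (\<omega> s) s j + \<omega> (Suc s) (Suc s) j"
    and "\<omega> (Suc s) (Suc s) (Suc s) = 0"
proof -
  obtain \<omega>' e where w: "\<omega>' \<in> set_pmf (ba_path m s)"
    "e \<in> set_pmf (Pi_pmf {1..m} 0 (\<lambda>_. attach_pmf (\<omega>' s) s))"
    "\<omega> = \<omega>'(Suc s := add_vertex m (Suc s) e (\<omega>' s))"
    using assms by (auto simp: set_map_pmf)
  note G = total_deg_ba_path[OF assms(1,2) w(1)]
  have e: "e i \<in> {1..s}" if "i \<in> {1..m}" for i
    using set_Pi_pmf_attach[OF _ w(2) that] G by simp
  show "\<omega> (Suc s) (Suc s) (Suc s) = 0"
  proof -
    have "{i \<in> {1..m}. {Suc s, Suc s} = {Suc s, e i}} = {}"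
      using e by (fastforce simp: doubleton_eq_iff)
    thus ?thesis using G unfolding w(3) add_vertex_def by simp
  qed
  have "\<omega> (Suc s) j v = \<omega> s j v" if "v \<in> {1..s}" for v
    using assms(4) that unfolding w(3) add_vertex_def by (auto simp: doubleton_eq_iff)
  moreover have "\<omega> (Suc s) j (Suc s) = \<omega> (Suc s) (Suc s) j"
    using G unfolding w(3) add_vertex_def by (simp add: insert_commute)
  ultimately show "deg (\<omega> (Suc s)) (Suc s) j = deg (\<omega> s) s j + \<omega> (Suc s) (Suc s) j"
    by (simp add: deg_def)
qed

text \<open>A vertex arriving after \<open>k\<close> only brings edges at itself, never one between \<open>j\<close> and \<open>k\<close>.\<close>

lemma ba_path_multiplicity_stable:
  assumes "m \<ge> 1" "k > m + 1" "j < k" "k \<le> n" "\<omega> \<in> set_pmf (ba_path m n)"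
  shows "\<omega> n k j = \<omega> k k j"
  using assms(4,5)
proof (induction n arbitrary: \<omega> rule: dec_induct)
  case (step n)
  obtain \<omega>' e where w: "\<omega>' \<in> set_pmf (ba_path m n)"
    "\<omega> = \<omega>'(Suc n := add_vertex m (Suc n) e (\<omega>' n))"
    using step.prems assms(2) step(1) by (auto simp: set_map_pmf)
  show ?case
    using step.IH[OF w(1)] step(1) assms(3) unfolding w(2) add_vertex_def
    by (auto simp: doubleton_eq_iff)
qed simp

section \<open>Mean degrees\<close>

\<comment> \<open>Automatic unfolding would turn every expectation over the process into one over a conditional law.\<close>
declare ba_path.simps(2) [simp del]

definition mean_deg :: "nat \<Rightarrow> nat \<Rightarrow> nat \<Rightarrow> real" where
  "mean_deg m s j = measure_pmf.expectation (ba_path m s) (\<lambda>\<omega>. real (deg (\<omega> s) s j))"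

text \<open>The total degree of the graph at time \<open>s\<close>, divided by \<open>m\<close>; see \<open>real_total_deg_ba_path\<close>.\<close>

abbreviation scaled_total :: "nat \<Rightarrow> nat \<Rightarrow> real" where
  "scaled_total m s \<equiv> 2 * real s - real m - 1"

lemma real_total_deg_ba_path:
  assumes "m \<ge> 1" "s \<ge> m + 1" "\<omega> \<in> set_pmf (ba_path m s)"
  shows "real (total_deg (\<omega> s) s) = m * scaled_total m s"
proof -
  have "real_of_int (int (total_deg (\<omega> s) s)) = real_of_int (2 * int m * int s - int m * (int m + 1))"
    using total_deg_ba_path[OF assms] by metis
  thus ?thesis by (simp add: algebra_simps)
qed

text \<open>
  Given the past, the multiplicity of the edge from the new vertex to \<open>j\<close> is binomial with mean
  \<open>m d\<^sub>j(s) / D\<^sub>s\<close>, and \<open>D\<^sub>s / m\<close> is not random, so that averaging over the past leaves the mean degree.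
  Both the recursion for mean degrees and the mean multiplicities rest on this.
\<close>

lemma mean_new_edges:
  assumes "m \<ge> 1" "s \<ge> m + 1" "j \<in> {1..s}"
  shows "measure_pmf.expectation (ba_path m (Suc s)) (\<lambda>\<omega>. real (\<omega> (Suc s) (Suc s) j))
           = mean_deg m s j / scaled_total m s"
proof -
  let ?P = "\<lambda>\<omega>. Pi_pmf {1..m} 0 (\<lambda>_. attach_pmf (\<omega> s) s)"
  let ?N = "\<lambda>\<omega> e. fun_upd \<omega> (Suc s) (add_vertex m (Suc s) e (\<omega> s))"
  let ?S = "set_pmf (ba_path m s)"
  have inner: "measure_pmf.expectation (map_pmf (?N \<omega>) (?P \<omega>))
      (\<lambda>\<omega>. real (\<omega> (Suc s) (Suc s) j)) = real (deg (\<omega> s) s j) / scaled_total m s"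
    if w: "\<omega> \<in> ?S" for \<omega>
  proof -
    note G = total_deg_ba_path[OF assms(1,2) w]
    have "add_vertex m (Suc s) e (\<omega> s) (Suc s) j = card {i \<in> {1..m}. e i = j}" for e
      using G assms(3) unfolding add_vertex_def
      by (auto simp: doubleton_eq_iff intro!: arg_cong[where f = card])
    hence "measure_pmf.expectation (map_pmf (?N \<omega>) (?P \<omega>))
      (\<lambda>\<omega>. real (\<omega> (Suc s) (Suc s) j)) = m * pmf (attach_pmf (\<omega> s) s) j"
      using expectation_number_of_hits[of "{1..m}" 0 "attach_pmf (\<omega> s) s" j]
      by (simp only: integral_map_pmf fun_upd_same finite_atLeastAtMost card_atLeastAtMost simp_thms diff_Suc_1)
    also have "\<dots> = real (deg (\<omega> s) s j) / scaled_total m s"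
      using G assms real_total_deg_ba_path[OF assms(1,2) w] by (simp add: pmf_attach_pmf)
    finally show ?thesis .
  qed
  have "measure_pmf.expectation (ba_path m (Suc s)) (\<lambda>\<omega>. real (\<omega> (Suc s) (Suc s) j))
     = (\<Sum>\<omega>\<in>?S. pmf (ba_path m s) \<omega> *\<^sub>R (real (deg (\<omega> s) s j) / scaled_total m s))"
  proof -
    have "measure_pmf.expectation (ba_path m (Suc s)) (\<lambda>\<omega>. real (\<omega> (Suc s) (Suc s) j))
       = measure_pmf.expectation (ba_path m s \<bind> (\<lambda>\<omega>. map_pmf (?N \<omega>) (?P \<omega>)))
           (\<lambda>\<omega>. real (\<omega> (Suc s) (Suc s) j))"
      using assms(2) by (simp add: ba_path.simps(2))
    also have "\<dots> = (\<Sum>\<omega>\<in>?S. pmf (ba_path m s) \<omega> *\<^sub>R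
       measure_pmf.expectation (map_pmf (?N \<omega>) (?P \<omega>)) (\<lambda>\<omega>. real (\<omega> (Suc s) (Suc s) j)))"
    proof (rule pmf_expectation_bind)
      show "finite (set_pmf (map_pmf (?N \<omega>) (?P \<omega>)))" if "\<omega> \<in> ?S" for \<omega>
        unfolding set_map_pmf
        using finite_set_Pi_pmf_attach total_deg_ba_path[OF assms(1,2) that] by blast
    qed (use finite_set_ba_path[OF assms(1)] in simp_all)
    also have "\<dots> = (\<Sum>\<omega>\<in>?S. pmf (ba_path m s) \<omega> *\<^sub>R (real (deg (\<omega> s) s j) / scaled_total m s))"
      by (rule sum.cong[OF refl], subst inner) simp_all
    finally show ?thesis .
  qed
  also have "\<dots> = measure_pmf.expectation (ba_path m s) (\<lambda>\<omega>. real (deg (\<omega> s) s j) / scaled_total m s)"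
    by (rule integral_measure_pmf[symmetric]) (use finite_set_ba_path[OF assms(1)] in auto)
  finally show ?thesis by (simp add: mean_deg_def)
qed

lemma mean_deg_initial:
  assumes "j \<in> {1..m + 1}"
  shows "mean_deg m (m + 1) j = m"
proof -
  have "deg (complete_graph (m + 1)) (m + 1) j = (\<Sum>w\<in>{1..m+1} - {j}. 1)"
    unfolding deg_def complete_graph_def using assms
    by (intro sum.mono_neutral_cong_right) auto
  thus ?thesis using assms by (simp add: mean_deg_def ba_path.simps(2))
qed

lemma mean_deg_Suc:
  assumes "m \<ge> 1" "s \<ge> m + 1" "j \<in> {1..s}"
  shows "mean_deg m (Suc s) j = mean_deg m s j * (1 + 1 / scaled_total m s)"
proof -
  let ?E = "\<lambda>f. measure_pmf.expectation (ba_path m (Suc s)) f :: real"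
  have old: "?E (\<lambda>\<omega>. real (deg (\<omega> s) s j)) = mean_deg m s j"
  proof -
    have "measure_pmf.expectation (map_pmf (\<lambda>\<omega>. \<omega> s) (ba_path m (Suc s))) (\<lambda>G. real (deg G s j))
      = measure_pmf.expectation (map_pmf (\<lambda>\<omega>. \<omega> s) (ba_path m s)) (\<lambda>G. real (deg G s j))"
      using ba_path_marginal[of s "Suc s" m] assms(2) by simp
    thus ?thesis by (simp add: mean_deg_def)
  qed
  have "mean_deg m (Suc s) j = ?E (\<lambda>\<omega>. real (deg (\<omega> s) s j) + real (\<omega> (Suc s) (Suc s) j))"
    unfolding mean_deg_def using ba_path_step(1)[OF assms(1,2) _ assms(3)]
    by (intro integral_cong_AE) (auto simp: AE_measure_pmf_iff)
  also have "\<dots> = ?E (\<lambda>\<omega>. real (deg (\<omega> s) s j)) + ?E (\<lambda>\<omega>. real (\<omega> (Suc s) (Suc s) j))"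
    by (intro Bochner_Integration.integral_add integrable_ba_path assms(1))
  also have "\<dots> = mean_deg m s j + mean_deg m s j / scaled_total m s"
    unfolding old mean_new_edges[OF assms] ..
  finally show ?thesis by (simp add: algebra_simps)
qed

text \<open>
  A new vertex always has degree \<open>m\<close>. In the mean this follows from \<open>mean_new_edges\<close> by summing over
  all old vertices.
\<close>

lemma mean_deg_new_vertex:
  assumes "m \<ge> 1" "s \<ge> m + 1"
  shows "mean_deg m (Suc s) (Suc s) = m"
proof -
  have pos: "scaled_total m s > 0" using assms by linarith
  have total: "(\<Sum>j\<in>{1..s}. mean_deg m s j) = m * scaled_total m s"
  proof -
    have "(\<Sum>j\<in>{1..s}. mean_deg m s j)
            = measure_pmf.expectation (ba_path m s) (\<lambda>\<omega>. real (total_deg (\<omega> s) s))"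
      unfolding mean_deg_def total_deg_def of_nat_sum
      by (rule Bochner_Integration.integral_sum[symmetric]) (rule integrable_ba_path[OF assms(1)])
    also have "\<dots> = measure_pmf.expectation (ba_path m s) (\<lambda>_. m * scaled_total m s)"
      using real_total_deg_ba_path[OF assms]
      by (intro integral_cong_AE) (simp_all add: AE_measure_pmf_iff)
    finally show ?thesis by simp
  qed
  have "deg (\<omega> (Suc s)) (Suc s) (Suc s) = (\<Sum>j\<in>{1..s}. \<omega> (Suc s) (Suc s) j)"
    if "\<omega> \<in> set_pmf (ba_path m (Suc s))" for \<omega>
    using ba_path_step(2)[OF assms that, of 1] assms by (simp add: deg_def)
  hence "mean_deg m (Suc s) (Suc s) = measure_pmf.expectation (ba_path m (Suc s))
     (\<lambda>\<omega>. \<Sum>j\<in>{1..s}. real (\<omega> (Suc s) (Suc s) j))"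
    unfolding mean_deg_def by (intro integral_cong_AE) (simp_all add: AE_measure_pmf_iff)
  also have "\<dots> = (\<Sum>j\<in>{1..s}. mean_deg m s j / scaled_total m s)"
    by (subst Bochner_Integration.integral_sum[OF integrable_ba_path[OF assms(1)]],
        rule sum.cong[OF refl], rule mean_new_edges[OF assms])
  also have "\<dots> = m"
    using pos unfolding sum_divide_distrib[symmetric] total by simp
  finally show ?thesis .
qed

lemma mean_deg_eq:
  assumes "m \<ge> 1" "j \<ge> 1" "max j (m + 1) \<le> s"
  shows "mean_deg m s j = m * (\<Prod>r\<in>{max j (m + 1)..<s}. 1 + 1 / scaled_total m r)"
  using assms(3)
proof (induction s rule: dec_induct)
  case base
  show ?case
  proof (cases "j \<le> m + 1")
    case True
    hence "max j (m + 1) = m + 1" "j \<in> {1..m + 1}" using assms(2) by auto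
    thus ?thesis using mean_deg_initial[of j m] by simp
  next
    case False
    then obtain s where s: "j = Suc s" "s \<ge> m + 1" by (cases j) auto
    hence "max j (m + 1) = j" by simp
    thus ?thesis using mean_deg_new_vertex[OF assms(1) s(2)] s(1) by simp
  qed
next
  case (step s)
  have "s \<ge> m + 1" "j \<in> {1..s}" using step(1) assms by auto
  note recursion = mean_deg_Suc[OF assms(1) this]
  show ?case
    unfolding recursion step(3) prod.atLeastLessThan_Suc[OF step(1)] by (rule mult.assoc)
qed

lemma mean_attach_prob_eq_mean_deg:
  assumes "m \<ge> 1" "m + 1 < k" "k \<le> n"
  shows "mean_attach_prob m n k j = mean_deg m (k - 1) j / (m * scaled_total m (k - 1))"
proof -
  let ?s = "k - 1"
  have s: "?s \<ge> m + 1" "?s \<le> n" using assms by auto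
  let ?f = "\<lambda>G. real (deg G ?s j) / real (total_deg G ?s)"
  have "mean_attach_prob m n k j = measure_pmf.expectation (map_pmf (\<lambda>\<omega>. \<omega> ?s) (ba_path m n)) ?f"
    by (simp add: mean_attach_prob_def attach_prob_def [abs_def])
  also have "\<dots> = measure_pmf.expectation (ba_path m ?s) (\<lambda>\<omega>. ?f (\<omega> ?s))"
    using ba_path_marginal[OF s(2,1)] by simp
  also have "\<dots> = measure_pmf.expectation (ba_path m ?s) (\<lambda>\<omega>. real (deg (\<omega> ?s) ?s j) / (m * scaled_total m ?s))"
    using real_total_deg_ba_path[OF assms(1) s(1)]
    by (intro integral_cong_AE) (auto simp: AE_measure_pmf_iff)
  finally show ?thesis by (simp add: mean_deg_def)
qed

lemma mean_mult_eq_mean_attach_prob: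
  assumes "m \<ge> 1" "m + 1 < k" "k \<le> n" "1 \<le> j" "j < k"
  shows "mean_mult m n k j = m * mean_attach_prob m n k j"
proof -
  obtain s where k: "k = Suc s" "s \<ge> m + 1" "j \<in> {1..s}" using assms by (cases k) auto
  have "mean_mult m n k j = measure_pmf.expectation (map_pmf (\<lambda>\<omega>. \<omega> k) (ba_path m n)) (\<lambda>G. real (G k j))"
    unfolding mean_mult_def integral_map_pmf
    using ba_path_multiplicity_stable[OF assms(1,2,5,3)]
    by (intro integral_cong_AE) (auto simp: AE_measure_pmf_iff)
  also have "\<dots> = measure_pmf.expectation (ba_path m k) (\<lambda>\<omega>. real (\<omega> k k j))"
    using assms ba_path_marginal[of k n m] by simp
  also have "\<dots> = mean_deg m s j / scaled_total m s"
    using mean_new_edges[OF assms(1) k(2,3)] k(1) by simp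
  finally show ?thesis
    using mean_attach_prob_eq_mean_deg[OF assms(1-3), of j] k(1) assms(1) by simp
qed

section \<open>The size of the mean attachment probabilities\<close>

abbreviation growth_factor :: "nat \<Rightarrow> nat \<Rightarrow> nat \<Rightarrow> real" where
  "growth_factor m i s \<equiv> (\<Prod>r\<in>{i..<s}. 1 + 1 / scaled_total m r)"

lemma mean_attach_prob_eq_growth_factor:
  assumes "m \<ge> 1" "m + 1 < k" "k \<le> n" "1 \<le> j" "j < k"
  shows "mean_attach_prob m n k j = growth_factor m (max j (m + 1)) (k - 1) / scaled_total m (k - 1)"
proof -
  have "max j (m + 1) \<le> k - 1" using assms(2,5) by linarith
  hence "mean_deg m (k - 1) j = m * growth_factor m (max j (m + 1)) (k - 1)"
    by (rule mean_deg_eq[OF assms(1,4)])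
  thus ?thesis
    unfolding mean_attach_prob_eq_mean_deg[OF assms(1-3)] using assms(1) by simp
qed

lemma mean_attach_prob_pos:
  assumes "m \<ge> 1" "m + 1 < k" "k \<le> n" "1 \<le> j" "j < k"
  shows "mean_attach_prob m n k j > 0"
proof -
  have total_pos: "scaled_total m r > 0" if "m + 1 \<le> r" for r
    using that assms(1) by linarith
  have "1 + 1 / scaled_total m r > 0" if "r \<in> {max j (m + 1)..<k - 1}" for r
    using total_pos[of r] that by (intro add_pos_pos) auto
  hence "growth_factor m (max j (m + 1)) (k - 1) > 0" by (intro prod_pos) blast
  thus ?thesis
    unfolding mean_attach_prob_eq_growth_factor[OF assms] using total_pos[of "k - 1"] assms(2) by simp
qed

text \<open>
  With \<open>a = 2 s - m - 1\<close>, which increases by 2 when \<open>s\<close> does, each squared factor satisfies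
  \<open>(a + 2) / a \<le> (1 + 1 / a)\<^sup>2 \<le> (a + 1) / (a - 1)\<close>, and both outer products telescope. The bounds
  make the asymptotic square root behaviour explicit, without Stirling's formula.
\<close>

lemma growth_factor_bounds:
  assumes "m \<ge> 1" "m + 1 \<le> i" "i \<le> s"
  shows "scaled_total m s / scaled_total m i \<le> (growth_factor m i s)\<^sup>2"
    and "(growth_factor m i s)\<^sup>2 \<le> (scaled_total m s - 1) / (scaled_total m i - 1)"
proof -
  have "scaled_total m s / scaled_total m i \<le> (growth_factor m i s)\<^sup>2 \<and>
        (growth_factor m i s)\<^sup>2 \<le> (scaled_total m s - 1) / (scaled_total m i - 1)"
    using assms(3)
  proof (induction s rule: dec_induct)
    case base
    have "scaled_total m i > 1" using assms(1,2) by linarith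
    thus ?case by simp
  next
    case (step s)
    define a where "a = scaled_total m s"
    have a: "a > 1" "scaled_total m i > 1" using assms(1,2) step(1) unfolding a_def by linarith+
    have next_a: "scaled_total m (Suc s) = a + 2" by (simp add: a_def)
    have split: "(growth_factor m i (Suc s))\<^sup>2 = (growth_factor m i s)\<^sup>2 * (1 + 1 / a)\<^sup>2"
      unfolding prod.atLeastLessThan_Suc[OF step(1)] a_def by (rule power_mult_distrib)
    have lower: "(a + 2) / a \<le> (1 + 1 / a)\<^sup>2"
      using a by (simp add: field_simps power2_eq_square)
    have upper: "(1 + 1 / a)\<^sup>2 \<le> (a + 1) / (a - 1)"
      using a by (simp add: divide_simps power2_eq_square) (simp add: algebra_simps)
    have "(a + 2) / scaled_total m i = a / scaled_total m i * ((a + 2) / a)"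
      using a by simp
    also have "\<dots> \<le> (growth_factor m i s)\<^sup>2 * (1 + 1 / a)\<^sup>2"
      using step(3) lower a unfolding a_def by (intro mult_mono) auto
    finally have 1: "(a + 2) / scaled_total m i \<le> (growth_factor m i s)\<^sup>2 * (1 + 1 / a)\<^sup>2" .
    have "(growth_factor m i s)\<^sup>2 * (1 + 1 / a)\<^sup>2
            \<le> (a - 1) / (scaled_total m i - 1) * ((a + 1) / (a - 1))"
      using step(3) upper a unfolding a_def by (intro mult_mono) auto
    also have "\<dots> = (a + 2 - 1) / (scaled_total m i - 1)" using a by simp
    finally show ?case using 1 unfolding split next_a by blast
  qed
  thus "scaled_total m s / scaled_total m i \<le> (growth_factor m i s)\<^sup>2"
    and "(growth_factor m i s)\<^sup>2 \<le> (scaled_total m s - 1) / (scaled_total m i - 1)" by blast+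
qed

section \<open>The variance of the Poisson matrix\<close>

lemma edges_per_vertex_admissible:
  assumes "n \<in> admissible c" "c > 0"
  shows "real (edges_per_vertex c n) = c * real n" "edges_per_vertex c n \<ge> 1"
proof -
  obtain z where z: "c * real n = of_int z" using assms by (auto simp: admissible_def Ints_def)
  have "c * real n > 0" using assms by (simp add: admissible_def)
  hence "z \<ge> 1" using z by simp
  thus "real (edges_per_vertex c n) = c * real n" "edges_per_vertex c n \<ge> 1"
    by (simp_all add: edges_per_vertex_def z)
qed

text \<open>
  Dividing by \<open>\<surd>m\<close> in the definition of \<open>H\<close> cancels the factor \<open>m\<close> in the mean multiplicity.
\<close>

lemma variance_H_eq_mean_attach_prob:
  assumes P: "independent_poisson (edges_per_vertex c n) n (\<Omega> n) (P n)"
    and c: "n \<in> admissible c" "c > 0"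
    and kj: "edges_per_vertex c n + 1 < k" "k \<le> n" "1 \<le> j" "j < k"
  shows "variance_H c \<Omega> P n k j = mean_attach_prob (edges_per_vertex c n) n k j"
proof -
  define m where "m = edges_per_vertex c n"
  have m: "m \<ge> 1" using edges_per_vertex_admissible[OF c] by (simp add: m_def)
  have kj': "(k, j) \<in> poisson_index m n" using kj by (simp add: poisson_index_def m_def)
  interpret prob_space "\<Omega> n" using P by (simp add: independent_poisson_def)
  have indep: "indep_vars (\<lambda>_. count_space UNIV) (\<lambda>(k, j). P n k j) (poisson_index m n)"
    and distr: "distr (\<Omega> n) (count_space UNIV) (P n k j) = measure_pmf (poisson_pmf (mean_mult m n k j))"
    using P kj' by (auto simp: independent_poisson_def m_def)
  have meas: "P n k j \<in> \<Omega> n \<rightarrow>\<^sub>M count_space UNIV"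
    using indep kj' by (force simp: indep_vars_def)
  have mean: "mean_mult m n k j = m * mean_attach_prob m n k j"
    using mean_mult_eq_mean_attach_prob m kj by (simp add: m_def)
  have "mean_attach_prob m n k j > 0" using mean_attach_prob_pos m kj by (simp add: m_def)
  hence pos: "mean_mult m n k j > 0" using m mean by simp
  have H: "poisson_H m n (P n) k j = (\<lambda>x. (real (P n k j x) - mean_mult m n k j) / sqrt (real m))"
    using kj' by (simp add: poisson_H_def fun_eq_iff)
  have "variance_H c \<Omega> P n k j = mean_mult m n k j / (sqrt (real m))\<^sup>2"
    unfolding variance_H_def m_def[symmetric] H by (rule poisson_variance[OF meas distr pos])
  thus ?thesis using m mean by (simp add: m_def)
qed

lemma variance_H_commute: "variance_H c \<Omega> P n k j = variance_H c \<Omega> P n j k"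
proof -
  have "poisson_H m n Q k j = poisson_H m n Q j k" for m and Q :: "nat \<Rightarrow> nat \<Rightarrow> 'a \<Rightarrow> nat"
    by (auto simp: poisson_H_def poisson_index_def fun_eq_iff)
  thus ?thesis by (simp only: variance_H_def)
qed

section \<open>The limit along admissible sizes\<close>

lemma eventually_along_admissible: "eventually (\<lambda>n. n \<in> admissible c) (along c)"
  by (simp add: along_def eventually_inf_principal)

lemma tendsto_inverse_along: "((\<lambda>n. 1 / real n) \<longlongrightarrow> 0) (along c)"
  using lim_1_over_n by (rule tendsto_mono[rotated]) (simp add: along_def)

lemma kernel_u_eq_sqrt:
  assumes "c < 2 * t"
  shows "kernel_u c t = 1 / sqrt (2 * t - c)"
proof -
  have "kernel_u c t = inverse ((2 * t - c) powr (1 / 2))"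
    unfolding kernel_u_def by (simp flip: powr_minus)
  thus ?thesis using assms by (simp add: powr_half_sqrt inverse_eq_divide)
qed

text \<open>
  The sequence \<open>p\<close> stands for the mean attachment probability of the pair under consideration, \<open>i\<close>
  for the time at which its older vertex starts to gain degree, and \<open>s\<close> for the time just before
  its younger vertex arrives. The square of \<open>n p\<close> is squeezed between the bounds of
  \<open>growth_factor_bounds\<close>, rescaled by \<open>n\<close>.
\<close>

lemma tendsto_mean_attach_prob:
  fixes c :: real and i s :: "nat \<Rightarrow> nat" and p :: "nat \<Rightarrow> real"
  defines "m \<equiv> edges_per_vertex c"
  assumes c: "c > 0"
    and ev: "eventually (\<lambda>n. m n + 1 \<le> i n \<and> i n \<le> s n \<and>
               p n = growth_factor (m n) (i n) (s n) / scaled_total (m n) (s n)) (along c)"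
    and a: "((\<lambda>n. real (i n) / real n) \<longlongrightarrow> a) (along c)" "c < 2 * a"
    and b: "((\<lambda>n. real (s n) / real n) \<longlongrightarrow> b) (along c)" "c < 2 * b"
  shows "((\<lambda>n. real n * p n) \<longlongrightarrow> kernel_u c a * kernel_u c b) (along c)"
proof -
  define h where "h = (\<lambda>t n. scaled_total (m n) (t n) / real n)"
  have h: "(h t \<longlongrightarrow> 2 * l - c) (along c)" if "((\<lambda>n. real (t n) / real n) \<longlongrightarrow> l) (along c)" for t l
  proof -
    have "((\<lambda>n. 2 * (real (t n) / real n) - c - 1 / real n) \<longlongrightarrow> 2 * l - c - 0) (along c)"
      by (intro tendsto_intros that tendsto_inverse_along)
    moreover have "eventually (\<lambda>n. 2 * (real (t n) / real n) - c - 1 / real n = h t n) (along c)"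
      using eventually_along_admissible
    proof eventually_elim
      case (elim n)
      thus ?case using edges_per_vertex_admissible(1)[OF elim c]
        by (simp add: h_def m_def admissible_def field_simps)
    qed
    ultimately show ?thesis by (simp add: tendsto_cong)
  qed
  note hi = h[OF a(1)] and hs = h[OF b(1)]
  define x y where "x = 2 * a - c" and "y = 2 * b - c"
  have xy: "x > 0" "y > 0" using a(2) b(2) by (simp_all add: x_def y_def)
  have ev': "eventually (\<lambda>n. 1 / (h i n * h s n) \<le> (real n * p n)\<^sup>2 \<and>
      (real n * p n)\<^sup>2 \<le> (h s n - 1 / real n) / ((h s n)\<^sup>2 * (h i n - 1 / real n)) \<and> p n \<ge> 0) (along c)"
    using ev eventually_along_admissible
  proof eventually_elim
    case (elim n)
    have n: "real n > 0" and m: "m n \<ge> 1"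
      using elim(2) edges_per_vertex_admissible(2)[OF elim(2) c] by (simp_all add: admissible_def m_def)
    let ?g = "growth_factor (m n) (i n) (s n)" and ?a = "scaled_total (m n) (i n)" and ?b = "scaled_total (m n) (s n)"
    have pos: "?a > 1" "?b > 1" using m elim(1) by linarith+
    have "?g \<ge> 0"
    proof (rule prod_nonneg)
      fix r assume "r \<in> {i n..<s n}"
      hence "scaled_total (m n) r > 0" using m elim(1) by (auto; linarith)
      thus "1 + 1 / scaled_total (m n) r \<ge> 0" by simp
    qed
    hence "p n \<ge> 0" using elim(1) pos by simp
    have sq: "(real n * p n)\<^sup>2 = ?g\<^sup>2 * ((real n)\<^sup>2 / ?b\<^sup>2)"
      using elim(1) by (simp add: power_mult_distrib power_divide)
    have "1 / (h i n * h s n) = ?b / ?a * ((real n)\<^sup>2 / ?b\<^sup>2)"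
    proof -
      have "1 / (u / N * (v / N)) = v / u * (N\<^sup>2 / v\<^sup>2)" if "u > 0" "v > 0" "N > 0" for u v N :: real
        using that by (simp add: power2_eq_square field_simps)
      thus ?thesis using pos n unfolding h_def by simp
    qed
    also have "\<dots> \<le> (real n * p n)\<^sup>2"
      unfolding sq using growth_factor_bounds(1) m elim(1) by (intro mult_right_mono) auto
    finally have 1: "1 / (h i n * h s n) \<le> (real n * p n)\<^sup>2" .
    have "(real n * p n)\<^sup>2 \<le> (?b - 1) / (?a - 1) * ((real n)\<^sup>2 / ?b\<^sup>2)"
      unfolding sq using growth_factor_bounds(2) m elim(1) by (intro mult_right_mono) auto
    also have "\<dots> = (h s n - 1 / real n) / ((h s n)\<^sup>2 * (h i n - 1 / real n))"
    proof -
      have "h s n - 1 / real n = (?b - 1) / real n" "h i n - 1 / real n = (?a - 1) / real n"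
        by (simp_all only: h_def diff_divide_distrib)
      thus ?thesis using n by (simp add: h_def power2_eq_square)
    qed
    finally show ?case using 1 \<open>p n \<ge> 0\<close> by blast
  qed
  have "((\<lambda>n. (real n * p n)\<^sup>2) \<longlongrightarrow> 1 / (x * y)) (along c)"
  proof (rule tendsto_sandwich)
    show "((\<lambda>n. 1 / (h i n * h s n)) \<longlongrightarrow> 1 / (x * y)) (along c)"
      using hi hs xy unfolding x_def y_def by (intro tendsto_intros) auto
    have "((\<lambda>n. (h s n - 1 / real n) / ((h s n)\<^sup>2 * (h i n - 1 / real n)))
            \<longlongrightarrow> (y - 0) / (y\<^sup>2 * (x - 0))) (along c)"
      using hi hs xy tendsto_inverse_along unfolding x_def y_def by (intro tendsto_intros) auto
    also have "(y - 0) / (y\<^sup>2 * (x - 0)) = 1 / (x * y)"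
      using xy by (simp add: power2_eq_square)
    finally show "((\<lambda>n. (h s n - 1 / real n) / ((h s n)\<^sup>2 * (h i n - 1 / real n))) \<longlongrightarrow> 1 / (x * y)) (along c)" .
  qed (use ev' in \<open>auto elim: eventually_mono\<close>)
  hence "((\<lambda>n. sqrt ((real n * p n)\<^sup>2)) \<longlongrightarrow> sqrt (1 / (x * y))) (along c)"
    by (rule tendsto_real_sqrt)
  moreover have "eventually (\<lambda>n. sqrt ((real n * p n)\<^sup>2) = real n * p n) (along c)"
    using ev' by eventually_elim simp
  moreover have "sqrt (1 / (x * y)) = kernel_u c a * kernel_u c b"
    using a(2) b(2) by (simp add: kernel_u_eq_sqrt x_def y_def real_sqrt_divide real_sqrt_mult)
  ultimately show ?thesis by (simp add: tendsto_cong)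
qed

text \<open>
  As \<open>max x y > c\<close>, the larger index eventually exceeds \<open>m + 1\<close>, so the pair carries a Poisson
  variable no matter which of the two indices is larger.
\<close>

lemma tendsto_variance_H:
  assumes P: "\<And>n. n \<in> admissible c \<Longrightarrow> independent_poisson (edges_per_vertex c n) n (\<Omega> n) (P n)"
    and c: "c > 0" and xy: "c < max x y" and jk: "index_sequences c x y j k"
  shows "((\<lambda>n. real n * variance_H c \<Omega> P n (k n) (j n))
           \<longlongrightarrow> kernel_u c (max (min x y) c) * kernel_u c (max x y)) (along c)"
proof -
  define m where "m = edges_per_vertex c"
  define lo hi where "lo = (\<lambda>n. min (j n) (k n))" and "hi = (\<lambda>n. max (j n) (k n))"
  have j: "((\<lambda>n. real (j n) / real n) \<longlongrightarrow> x) (along c)" and k: "((\<lambda>n. real (k n) / real n) \<longlongrightarrow> y) (along c)"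
    using jk by (simp_all add: index_sequences_def)
  have lo: "((\<lambda>n. real (lo n) / real n) \<longlongrightarrow> min x y) (along c)"
    using tendsto_min[OF j k] by (simp add: lo_def of_nat_min min_divide_distrib_right)
  have hi: "((\<lambda>n. real (hi n) / real n) \<longlongrightarrow> max x y) (along c)"
    using tendsto_max[OF j k] by (simp add: hi_def of_nat_max max_divide_distrib_right)
  have m: "((\<lambda>n. real (m n + 1) / real n) \<longlongrightarrow> c) (along c)"
  proof -
    have "((\<lambda>n. c + 1 / real n) \<longlongrightarrow> c + 0) (along c)" by (intro tendsto_intros tendsto_inverse_along)
    moreover have "eventually (\<lambda>n. c + 1 / real n = real (m n + 1) / real n) (along c)"
      using eventually_along_admissible
    proof eventually_elim
      case (elim n)
      thus ?case using edges_per_vertex_admissible(1)[OF elim c]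
        by (simp add: m_def admissible_def field_simps)
    qed
    ultimately show ?thesis by (simp add: tendsto_cong)
  qed
  have i: "((\<lambda>n. real (max (lo n) (m n + 1)) / real n) \<longlongrightarrow> max (min x y) c) (along c)"
    using tendsto_max[OF lo m] by (simp add: of_nat_max max_divide_distrib_right del: of_nat_add of_nat_Suc)
  have late: "eventually (\<lambda>n. m n + 1 < hi n) (along c)"
  proof -
    have "eventually (\<lambda>n. real (hi n) / real n - real (m n + 1) / real n > 0) (along c)"
      using xy by (intro order_tendstoD(1)[OF tendsto_diff[OF hi m]]) simp
    thus ?thesis
      by eventually_elim (auto simp: zero_less_divide_iff simp flip: diff_divide_distrib)
  qed
  have s: "((\<lambda>n. real (hi n - 1) / real n) \<longlongrightarrow> max x y) (along c)"
  proof -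
    have "((\<lambda>n. real (hi n) / real n - 1 / real n) \<longlongrightarrow> max x y - 0) (along c)"
      by (intro tendsto_intros hi tendsto_inverse_along)
    moreover have "eventually (\<lambda>n. real (hi n) / real n - 1 / real n = real (hi n - 1) / real n) (along c)"
      using late by eventually_elim (simp add: of_nat_diff diff_divide_distrib)
    ultimately show ?thesis by (simp add: tendsto_cong)
  qed
  let ?p = "\<lambda>n. mean_attach_prob (m n) n (hi n) (lo n)"
  have ord: "1 \<le> lo n \<and> lo n < hi n \<and> hi n \<le> n" if "n \<in> admissible c" for n
    using jk that unfolding lo_def hi_def index_sequences_def by fastforce
  have "((\<lambda>n. real n * ?p n) \<longlongrightarrow> kernel_u c (max (min x y) c) * kernel_u c (max x y)) (along c)"
  proof (rule tendsto_mean_attach_prob[OF c _ i _ s])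
    show "eventually (\<lambda>n. edges_per_vertex c n + 1 \<le> max (lo n) (m n + 1) \<and> max (lo n) (m n + 1) \<le> hi n - 1 \<and>
       ?p n = growth_factor (edges_per_vertex c n) (max (lo n) (m n + 1)) (hi n - 1) / scaled_total (edges_per_vertex c n) (hi n - 1)) (along c)"
      using late eventually_along_admissible
    proof eventually_elim
      case (elim n)
      have "m n \<ge> 1" using edges_per_vertex_admissible(2)[OF elim(2) c] by (simp add: m_def)
      from mean_attach_prob_eq_growth_factor[OF this elim(1)] show ?case
        using ord[OF elim(2)] elim(1) by (auto simp: m_def)
    qed
  qed (use c xy in auto)
  moreover have "eventually (\<lambda>n. real n * ?p n = real n * variance_H c \<Omega> P n (k n) (j n)) (along c)"
    using late eventually_along_admissible
  proof eventually_elim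
    case (elim n)
    have "variance_H c \<Omega> P n (hi n) (lo n) = ?p n"
      using variance_H_eq_mean_attach_prob[of c n \<Omega> P, OF P[OF elim(2)] elim(2) c]
        elim(1) ord[OF elim(2)]
      by (simp add: m_def)
    moreover have "variance_H c \<Omega> P n (hi n) (lo n) = variance_H c \<Omega> P n (k n) (j n)"
      using variance_H_commute[of c \<Omega> P n] by (auto simp: lo_def hi_def min_def max_def)
    ultimately show ?case by simp
  qed
  ultimately show ?thesis by (simp add: tendsto_cong)
qed

text \<open>
  The profile is defined by a description operator ranging over all index sequences for \<open>(x, y)\<close>;
  it determines a number only if there is at least one such sequence. Rounding \<open>x n\<close> and \<open>y n\<close>
  down gives one, up to a shift by 1 where the two values coincide. That two distinct indices exist
  for every admissible \<open>n\<close> is due to \<open>1 \<le> c n < n\<close>.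
\<close>

lemma index_sequences_exist:
  assumes c: "0 < c" "c < 1" and xy: "x \<in> {0..1}" "y \<in> {0..1}"
  shows "\<exists>j k. index_sequences c x y j k"
proof -
  \<comment> \<open>The maximum with 1 only matters when \<open>t n < 1\<close>, as there is no vertex 0.\<close>
  define r where "r = (\<lambda>t n. max 1 (nat \<lfloor>t * real n\<rfloor>))"
  define k where "k = (\<lambda>n. if r y n \<noteq> r x n then r y n else if r x n = 1 then 2 else r x n - 1)"
  have r: "\<bar>real (r t n) - t * real n\<bar> \<le> 1" "r t n \<ge> 1" "n \<ge> 1 \<Longrightarrow> r t n \<le> n" if "t \<in> {0..1}" for t n
  proof -
    define q where "q = t * real n"
    have q: "0 \<le> q" "q \<le> real n" using that by (auto simp: q_def mult_left_le_one_le)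
    have "real (nat \<lfloor>q\<rfloor>) = of_int \<lfloor>q\<rfloor>" using q(1) by simp
    hence "\<bar>real (max 1 (nat \<lfloor>q\<rfloor>)) - q\<bar> \<le> 1" using q(1) unfolding max_def by (simp; linarith)
    thus "\<bar>real (r t n) - t * real n\<bar> \<le> 1" by (simp only: r_def q_def)
    have "nat \<lfloor>q\<rfloor> \<le> n" using q by linarith
    thus "r t n \<ge> 1" "n \<ge> 1 \<Longrightarrow> r t n \<le> n" by (simp_all add: r_def q_def)
  qed
  \<comment> \<open>The bound 2 allows 1 for the rounding and 1 for the shift in \<open>k\<close>.\<close>
  have lim: "((\<lambda>n. real (q n) / real n) \<longlongrightarrow> t) (along c)"
    if q: "\<And>n. \<bar>real (q n) - t * real n\<bar> \<le> 2" for q t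
  proof (rule Lim_transform2)
    show "((\<lambda>n. t) \<longlongrightarrow> t) (along c)" by simp
    have "((\<lambda>n. 2 * (1 / real n)) \<longlongrightarrow> 2 * 0) (along c)" by (intro tendsto_intros tendsto_inverse_along)
    hence b: "((\<lambda>n. 2 * (1 / real n)) \<longlongrightarrow> 0) (along c)" by simp
    show "((\<lambda>n. t - real (q n) / real n) \<longlongrightarrow> 0) (along c)"
    proof (rule tendsto_rabs_zero_cancel, rule tendsto_sandwich[OF _ _ tendsto_const b])
      show "eventually (\<lambda>n. \<bar>t - real (q n) / real n\<bar> \<le> 2 * (1 / real n)) (along c)"
        using eventually_along_admissible
      proof eventually_elim
        case (elim n)
        hence n: "real n > 0" by (simp add: admissible_def)
        hence "t - real (q n) / real n = - ((real (q n) - t * real n) / real n)"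
          by (simp add: field_simps)
        hence "\<bar>t - real (q n) / real n\<bar> = \<bar>real (q n) - t * real n\<bar> / real n"
          by (simp only: abs_minus_cancel abs_divide abs_of_nat)
        thus ?case using q[of n] n by (simp add: divide_right_mono)
      qed
    qed simp
  qed
  have "\<bar>real (r x n) - x * real n\<bar> \<le> 2" for n using r(1)[OF xy(1), of n] by simp
  moreover have "\<bar>real (k n) - y * real n\<bar> \<le> 2" for n
    using r(1)[OF xy(2), of n] r(2)[OF xy(1), of n] unfolding k_def
    by (auto simp: of_nat_diff)
  moreover have "r x n \<in> {1..n} \<and> k n \<in> {1..n} \<and> k n \<noteq> r x n" if n: "n \<in> admissible c" for n
  proof -
    have "c * real n < real n" using c n by (simp add: admissible_def)
    hence "real (edges_per_vertex c n) < real n" "edges_per_vertex c n \<ge> 1"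
      using edges_per_vertex_admissible[OF n c(1)] by simp_all
    hence "n \<ge> 2" by simp
    thus ?thesis
      using r(2,3)[OF xy(1), of n] r(2,3)[OF xy(2), of n] unfolding k_def by auto
  qed
  ultimately have "index_sequences c x y (r x) k"
    unfolding index_sequences_def using lim by blast
  thus ?thesis by blast
qed

section \<open>The variance profile\<close>

text \<open>Uniqueness of the limit needs infinitely many admissible sizes, hence a rational \<open>c\<close>.\<close>

lemma variance_profile_eq:
  assumes P: "\<And>n. n \<in> admissible c \<Longrightarrow> independent_poisson (edges_per_vertex c n) n (\<Omega> n) (P n)"
    and c: "c \<in> \<rat>" "0 < c" "c < 1" and xy: "x \<in> {0..1}" "y \<in> {0..1}" "c < max x y"
  shows "variance_profile c \<Omega> P x y = kernel_u c (max (min x y) c) * kernel_u c (max x y)"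
proof -
  obtain j k where jk: "index_sequences c x y j k"
    using index_sequences_exist[OF c(2,3) xy(1,2)] by blast
  have "(THE l. \<forall>j k. index_sequences c x y j k \<longrightarrow>
           ((\<lambda>n. real n * variance_H c \<Omega> P n (k n) (j n)) \<longlongrightarrow> l) (along c))
        = kernel_u c (max (min x y) c) * kernel_u c (max x y)"
  proof (rule the_equality)
    show "l = kernel_u c (max (min x y) c) * kernel_u c (max x y)"
      if "\<forall>j k. index_sequences c x y j k \<longrightarrow>
           ((\<lambda>n. real n * variance_H c \<Omega> P n (k n) (j n)) \<longlongrightarrow> l) (along c)" for l
      using that jk tendsto_variance_H[OF P c(2) xy(3) jk] along_nontrivial[OF c(1)]
      by (meson tendsto_unique)
  qed (use tendsto_variance_H[OF P c(2) xy(3)] in blast)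
  moreover have "\<not> (x \<in> set_A c \<and> y \<in> set_A c)" using xy(3) by (auto simp: set_A_def)
  ultimately show ?thesis by (simp only: variance_profile_def if_False)
qed

theorem proposition4p8:
  fixes c :: real
    and \<Omega> :: "nat \<Rightarrow> 'a measure"
    and P :: "nat \<Rightarrow> nat \<Rightarrow> nat \<Rightarrow> 'a \<Rightarrow> nat"
  assumes "c \<in> \<rat>" and "0 < c" and "c < 1 / 2"
    and "\<And>n. n \<in> admissible c \<Longrightarrow> independent_poisson (edges_per_vertex c n) n (\<Omega> n) (P n)"
  shows
    "(\<forall>n \<in> admissible c. \<forall>k j. edges_per_vertex c n + 1 < k \<and> k \<le> n \<and> 1 \<le> j \<and> j < k \<longrightarrow>
        variance_H c \<Omega> P n k j = mean_attach_prob (edges_per_vertex c n) n k j \<and>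
        real n * variance_H c \<Omega> P n k j = real n * mean_attach_prob (edges_per_vertex c n) n k j) \<and>
     (\<forall>n \<in> admissible c. \<forall>k \<in> {1..edges_per_vertex c n + 1}. \<forall>j \<in> {1..edges_per_vertex c n + 1}.
        variance_H c \<Omega> P n k j = 0) \<and>
     (\<forall>x \<in> {0..1}. \<forall>y \<in> {0..1}. (x, y) \<notin> set_A c \<times> set_A c \<longrightarrow>
        (\<forall>j k. index_sequences c x y j k \<longrightarrow>
           ((\<lambda>n. real n * variance_H c \<Omega> P n (k n) (j n)) \<longlongrightarrow> variance_profile c \<Omega> P x y) (along c)) \<and>
        variance_profile c \<Omega> P x y = 1 / c * mean_kernel c x y) \<and>
     (\<forall>x \<in> set_A c. \<forall>y \<in> set_A c. variance_profile c \<Omega> P x y = 0) \<and>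
     (\<forall>x \<in> set_A c. \<forall>y \<in> set_B c. variance_profile c \<Omega> P x y = 1 / sqrt c * kernel_u c y) \<and>
     (\<forall>x \<in> set_B c. \<forall>y \<in> set_A c. variance_profile c \<Omega> P x y = 1 / sqrt c * kernel_u c x) \<and>
     (\<forall>x \<in> set_B c. \<forall>y \<in> set_B c. variance_profile c \<Omega> P x y = kernel_u c x * kernel_u c y)"
proof -
  note P = assms(4)
  have c: "c \<in> \<rat>" "0 < c" "c < 1" using assms(1-3) by auto
  define L where "L = (\<lambda>x y. kernel_u c (max (min x y) c) * kernel_u c (max x y))"
  have u_c: "kernel_u c c = 1 / sqrt c" using c(2) by (simp add: kernel_u_eq_sqrt)
  have AB: "L x y = 1 / sqrt c * kernel_u c y" if "x \<in> set_A c" "y \<in> set_B c" for x y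
    using that by (simp add: L_def set_A_def set_B_def u_c)
  have BA: "L x y = 1 / sqrt c * kernel_u c x" if "x \<in> set_B c" "y \<in> set_A c" for x y
    using that by (simp add: L_def set_A_def set_B_def u_c)
  have BB: "L x y = kernel_u c x * kernel_u c y" if "x \<in> set_B c" "y \<in> set_B c" for x y
    using that by (simp add: L_def set_B_def min_def max_def)
  have cases: "x \<in> set_A c \<or> x \<in> set_B c" if "x \<in> {0..1}" for x
    using that by (auto simp: set_A_def set_B_def)
  have AorB: "x \<in> {0..1}" if "x \<in> set_A c \<or> x \<in> set_B c" for x
    using that c by (auto simp: set_A_def set_B_def)
  have in_B: "c < max x y" if "x \<in> set_B c \<or> y \<in> set_B c" for x y
    using that by (auto simp: set_B_def)
  have profile: "variance_profile c \<Omega> P x y = L x y"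
    if "x \<in> {0..1}" "y \<in> {0..1}" "c < max x y" for x y
    using variance_profile_eq[OF P c that] by (simp add: L_def)
  have kernel: "1 / c * mean_kernel c x y = L x y"
    if xy: "x \<in> {0..1}" "y \<in> {0..1}" "c < max x y" for x y
  proof -
    have disjoint: "\<not> (t \<in> set_A c \<and> t \<in> set_B c)" for t by (auto simp: set_A_def set_B_def)
    have root: "1 / c * (sqrt c * u) = 1 / sqrt c * u" for u
      using real_div_sqrt[of c] c(2) by (simp add: field_simps)
    consider "x \<in> set_A c" "y \<in> set_B c" | "x \<in> set_B c" "y \<in> set_A c" | "x \<in> set_B c" "y \<in> set_B c"
      using cases[OF xy(1)] cases[OF xy(2)] xy(3) by (fastforce simp: set_A_def set_B_def)
    thus ?thesis
    proof cases
      case 1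
      thus ?thesis using AB root by (simp add: mean_kernel_def)
    next
      case 2
      thus ?thesis using BA root disjoint by (auto simp: mean_kernel_def)
    next
      case 3
      thus ?thesis using BB disjoint c(2) by (auto simp: mean_kernel_def)
    qed
  qed
  have early: "variance_H c \<Omega> P n k j = 0"
    if "k \<in> {1..edges_per_vertex c n + 1}" "j \<in> {1..edges_per_vertex c n + 1}" for n k j
  proof -
    have "poisson_H (edges_per_vertex c n) n (P n) k j = (\<lambda>_. 0)"
      using that by (auto simp: poisson_H_def poisson_index_def)
    thus ?thesis by (simp add: variance_H_def)
  qed
  have late: "c < max x y" if "x \<in> {0..1}" "y \<in> {0..1}" "(x, y) \<notin> set_A c \<times> set_A c" for x y
    using that by (auto simp: set_A_def)
  have limit: "((\<lambda>n. real n * variance_H c \<Omega> P n (k n) (j n)) \<longlongrightarrow> L x y) (along c)"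
    if "c < max x y" "index_sequences c x y j k" for x y j k
    using tendsto_variance_H[OF P c(2) that] by (simp add: L_def)
  have zero: "variance_profile c \<Omega> P x y = 0" if "x \<in> set_A c" "y \<in> set_A c" for x y
    using that by (simp add: variance_profile_def)
  show ?thesis
  proof (intro conjI ballI allI impI)
    fix n k j
    assume n: "n \<in> admissible c" and "edges_per_vertex c n + 1 < k \<and> k \<le> n \<and> 1 \<le> j \<and> j < k"
    thus "variance_H c \<Omega> P n k j = mean_attach_prob (edges_per_vertex c n) n k j"
      and "real n * variance_H c \<Omega> P n k j = real n * mean_attach_prob (edges_per_vertex c n) n k j"
      using variance_H_eq_mean_attach_prob[of c n \<Omega> P, OF P[OF n] n c(2)] by auto
  qed (use early profile kernel limit late zero AB BA BB in_B AorB in metis)+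
qed

end
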